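(* Let $m,n\in\mathbb{N}$ and suppose $\Lambda\in\mathbb{R}^{m\times n}$ is nonresonant. Let $g:\mathbb{R}^m\to X$ be a map with values in a metric space $X$ with Borel $\sigma$-algebra $\mathcal{B}$ such that (a) $g$ is unit periodic with respect to its $m$ variables, i.e. $g(u+z)=g(u)$ for all $u\in\mathbb{R}^m$, $z\in\mathbb{Z}^m$; (b) $g$ is $\mathrm{mes}_m$-continuous. Then the composition $g\circ\Lambda:\mathbb{Z}^n\to X$ is $D$-distributed, with $D$ the probability measure on $(X,\mathcal{B})$ given by $$D(B)=\mathrm{mes}_m\big(V\cap g^{-1}(B)\big),\qquad B\in\mathcal{B},$$ where $V\subset\mathbb{R}^m$ is an arbitrary Lebesgue measurable cell. Furthermore, the algebra $\mathcal{S}_{g\circ\Lambda}$ generated by the map $g\circ\Lambda$ consists of $\Lambda$-quasiperiodic sets: $\mathcal{S}_{g\circ\Lambda}\subset\mathcal{Q}_m(\Lambda)$.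
   Context: $\mathbb{N}=\{1,2,3,\ldots\}$ and $\mathrm{mes}_m$ is the $m$-dimensional Lebesgue measure. For $a\in\mathbb{Z}^n$ and $\ell\in\mathbb{N}^n$ let $P_{a,\ell}=\{x\in\mathbb{Z}^n:\ a_k\le x_k<a_k+\ell_k \text{ for all }1\le k\le n\}$, and for $N\in\mathbb{N}$ let $\mathcal{P}_N=\{P_{a,\ell}:\ a\in\mathbb{Z}^n,\ \ell\in\mathbb{N}^n,\ \min_k\ell_k\ge N\}$. For $A\subset\mathbb{Z}^n$ put $\mathbf{F}_*(A)=\sup_{N\ge1}\inf_{P\in\mathcal{P}_N}\frac{\#(A\cap P)}{\#P}$ and $\mathbf{F}^*(A)=\inf_{N\ge1}\sup_{P\in\mathcal{P}_N}\frac{\#(A\cap P)}{\#P}$. The set $A$ is frequency measurable if $\mathbf{F}_*(A)=\mathbf{F}^*(A)$; the common value is the frequency $\mathbf{F}(A)$. Let $D$ be a countably additive probability measure on $(X,\mathcal{B})$. A map $h:\mathbb{Z}^n\to X$ is $D$-distributed if for every $B\in\mathcal{B}$ with $D(\partial B)=0$ the preimage $h^{-1}(B)$ is frequency measurable and $\mathbf{F}(h^{-1}(B))=D(B)$. In this case the algebra generated by $h$ is $\mathcal{S}_h=\{h^{-1}(B):\ B\in\mathcal{B},\ D(\partial B)=0\}$ (there is at most one $D$ for which $h$ is $D$-distributed). A matrix $\Lambda\in\mathbb{R}^{m\times n}$ is nonresonant if the $n+m$ rows of $\begin{bmatrix}I_n\\ \Lambda\end{bmatrix}$ are linearly independent over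 the rationals. A map on $\mathbb{R}^m$ is $\mathrm{mes}_m$-continuous if its set of discontinuity points has zero Lebesgue measure. A set $V\subset\mathbb{R}^m$ is a cell if its translations $V+z$, $z\in\mathbb{Z}^m$, form a partition of $\mathbb{R}^m$. For $G\subset\mathbb{R}^m$ let $Q_m(G,\Lambda)=\{x\in\mathbb{Z}^n:\ \Lambda x\in G+\mathbb{Z}^m\}$; the algebra of $\Lambda$-quasiperiodic sets is $\mathcal{Q}_m(\Lambda)=\{Q_m(G,\Lambda):\ G\subset[0,1)^m\text{ is Jordan measurable}\}$, where Jordan measurable means bounded with boundary of zero Lebesgue measure. *)

theory Defs
  imports "HOL-Probability.Probability_Measure"
begin

section \<open>Frequency of subsets of the integer lattice\<close>

definition int_box :: "int ^ 'n \<Rightarrow> nat ^ 'n \<Rightarrow> (int ^ 'n) set" where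
  "int_box a l = {x. \<forall>k. a $ k \<le> x $ k \<and> x $ k < a $ k + int (l $ k)}"

definition int_boxes :: "nat \<Rightarrow> (int ^ 'n) set set" where
  "int_boxes N = {int_box a l |a l. (\<forall>k. 1 \<le> l $ k) \<and> (\<forall>k. N \<le> l $ k)}"

definition density_in :: "(int ^ 'n) set \<Rightarrow> (int ^ 'n) set \<Rightarrow> real" where
  "density_in A P = real (card (A \<inter> P)) / real (card P)"

text \<open>All suprema and infima below are over nonempty families of values in \<open>[0, 1]\<close>, so the
  real-valued \<open>SUP\<close> and \<open>INF\<close> are the intended ones.\<close>

definition lower_freq :: "(int ^ 'n) set \<Rightarrow> real" where
  "lower_freq A = (SUP N\<in>{1..}. INF P\<in>int_boxes N. density_in A P)"

definition upper_freq :: "(int ^ 'n) set \<Rightarrow> real" where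
  "upper_freq A = (INF N\<in>{1..}. SUP P\<in>int_boxes N. density_in A P)"

definition freq_measurable :: "(int ^ 'n) set \<Rightarrow> bool" where
  "freq_measurable A \<longleftrightarrow> lower_freq A = upper_freq A"

text \<open>Meaningful only for frequency measurable sets.\<close>

definition freq :: "(int ^ 'n) set \<Rightarrow> real" where
  "freq A = lower_freq A"

section \<open>Distributed maps\<close>

definition map_distributed :: "'x::metric_space measure \<Rightarrow> (int ^ 'n \<Rightarrow> 'x) \<Rightarrow> bool" where
  "map_distributed D h \<longleftrightarrow>
     prob_space D \<and> sets D = sets borel \<and>
     (\<forall>B\<in>sets borel. measure D (frontier B) = 0 \<longrightarrow>
        freq_measurable (h -` B) \<and> freq (h -` B) = measure D B)"

text \<open>The measure \<open>D\<close> is an explicit argument; it is determined by \<open>h\<close> whenever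
  \<open>map_distributed D h\<close> holds.\<close>

definition generated_algebra ::
    "'x::metric_space measure \<Rightarrow> (int ^ 'n \<Rightarrow> 'x) \<Rightarrow> (int ^ 'n) set set" where
  "generated_algebra D h = {h -` B |B. B \<in> sets borel \<and> measure D (frontier B) = 0}"

section \<open>Nonresonant matrices\<close>

text \<open>The block matrix with the identity on top of \<open>\<Lambda>\<close>; its rows are indexed by the sum type.\<close>

definition id_stack :: "real ^ 'n ^ 'm \<Rightarrow> real ^ 'n ^ ('n + 'm)" where
  "id_stack \<Lambda> = (\<chi> i. case i of Inl k \<Rightarrow> (mat 1 :: real ^ 'n ^ 'n) $ k | Inr j \<Rightarrow> \<Lambda> $ j)"

abbreviation rat_scale :: "rat \<Rightarrow> real ^ 'n \<Rightarrow> real ^ 'n" where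
  "rat_scale q v \<equiv> of_rat q *\<^sub>R v"

text \<open>Independence of the rows as an indexed family: no repetitions, and the set of rows is
  independent.\<close>

definition nonresonant :: "real ^ 'n ^ 'm \<Rightarrow> bool" where
  "nonresonant \<Lambda> \<longleftrightarrow>
     inj (\<lambda>i. row i (id_stack \<Lambda>)) \<and> \<not> module.dependent rat_scale (rows (id_stack \<Lambda>))"

lemma module_rat_scale: "module (rat_scale :: rat \<Rightarrow> real ^ 'n \<Rightarrow> real ^ 'n)"
  by unfold_locales (simp_all add: of_rat_add of_rat_mult scaleR_add_left scaleR_add_right)

lemma nonresonant_iff:
  fixes \<Lambda> :: "real ^ 'n ^ 'm"
  shows "nonresonant \<Lambda> \<longleftrightarrow>
    (\<forall>c. (\<Sum>i\<in>UNIV. rat_scale (c i) (row i (id_stack \<Lambda>))) = 0 \<longrightarrow> (\<forall>i. c i = 0))"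
    (is "_ \<longleftrightarrow> ?R")
proof -
  interpret module "rat_scale :: rat \<Rightarrow> real ^ 'n \<Rightarrow> real ^ 'n"
    by (rule module_rat_scale)
  define f where "f i = row i (id_stack \<Lambda>)" for i
  have rows: "rows (id_stack \<Lambda>) = range f"
    by (auto simp: rows_def f_def)
  have dep: "dependent (range f) \<longleftrightarrow>
      (\<exists>u. (\<exists>v\<in>range f. u v \<noteq> 0) \<and> (\<Sum>v\<in>range f. rat_scale (u v) v) = 0)"
    by (rule dependent_finite) simp
  have "inj f \<and> \<not> dependent (range f) \<longleftrightarrow>
      (\<forall>c. (\<Sum>i\<in>UNIV. rat_scale (c i) (f i)) = 0 \<longrightarrow> (\<forall>i. c i = 0))" (is "?L \<longleftrightarrow> ?S")
  proof
    assume L: ?L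
    show ?S
    proof (intro allI impI)
      fix c i assume c: "(\<Sum>i\<in>UNIV. rat_scale (c i) (f i)) = 0"
      have sum0: "(\<Sum>v\<in>range f. rat_scale (c (inv f v)) v) = 0"
        using L c by (simp add: sum.reindex)
      have *: "u v = 0" if "(\<Sum>v\<in>range f. rat_scale (u v) v) = 0" "v \<in> range f" for u v
        using L that unfolding dep by blast
      have "c (inv f (f i)) = 0"
        by (rule *[OF sum0]) simp
      with L show "c i = 0" by simp
    qed
  next
    assume S: ?S
    have inj: "inj f"
    proof (rule injI, rule ccontr)
      fix i j assume ij: "f i = f j" "i \<noteq> j"
      define c :: "'n + 'm \<Rightarrow> rat" where "c k = (if k = i then 1 else 0) - (if k = j then 1 else 0)" for k
      have "(\<Sum>k\<in>UNIV. rat_scale (c k) (f k)) =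
          (\<Sum>k\<in>UNIV. (if k = i then f k else 0) - (if k = j then f k else 0))"
        by (rule sum.cong) (auto simp: c_def)
      also have "\<dots> = 0" using ij by (simp add: sum_subtractf)
      finally have "c i = 0" using S by blast
      with ij show False by (simp add: c_def)
    qed
    moreover have "\<not> dependent (range f)"
      unfolding dep
    proof clarify
      fix u i assume u: "u (f i) \<noteq> 0" "(\<Sum>v\<in>range f. rat_scale (u v) v) = 0"
      have "(\<Sum>k\<in>UNIV. rat_scale (u (f k)) (f k)) = 0"
        using u inj by (simp add: sum.reindex)
      with S have "u (f i) = 0" by (elim allE[of _ "\<lambda>k. u (f k)"]) auto
      with u show False by simp
    qed
    ultimately show ?L ..
  qed
  then show ?thesis
    by (simp add: nonresonant_def rows flip: f_def)
qed

section \<open>Cells and quasiperiodic sets\<close>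

definition vec_of_int :: "int ^ 'm \<Rightarrow> real ^ 'm" where
  "vec_of_int z = (\<chi> i. real_of_int (z $ i))"

definition translate_by :: "(real ^ 'm) set \<Rightarrow> int ^ 'm \<Rightarrow> (real ^ 'm) set" where
  "translate_by G z = (\<lambda>u. u + vec_of_int z) ` G"

text \<open>The partition is indexed by \<open>z\<close>: translates by distinct integer vectors are disjoint, which
  excludes, e.g., the whole space.\<close>

definition cell :: "(real ^ 'm) set \<Rightarrow> bool" where
  "cell V \<longleftrightarrow> (\<Union>z. translate_by V z) = UNIV \<and> disjoint_family (translate_by V)"

definition unit_periodic :: "(real ^ 'm \<Rightarrow> 'x) \<Rightarrow> bool" where
  "unit_periodic g \<longleftrightarrow> (\<forall>u z. g (u + vec_of_int z) = g u)"

definition mes_continuous :: "(real ^ 'm \<Rightarrow> 'x::metric_space) \<Rightarrow> bool" where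
  "mes_continuous g \<longleftrightarrow> {u. \<not> isCont g u} \<in> null_sets lebesgue"

definition jordan_measurable :: "(real ^ 'm) set \<Rightarrow> bool" where
  "jordan_measurable G \<longleftrightarrow> bounded G \<and> frontier G \<in> null_sets lebesgue"

definition quasiperiodic_set :: "(real ^ 'm) set \<Rightarrow> real ^ 'n ^ 'm \<Rightarrow> (int ^ 'n) set" where
  "quasiperiodic_set G \<Lambda> = {x. \<Lambda> *v vec_of_int x \<in> (\<Union>z. translate_by G z)}"

definition quasiperiodic_algebra :: "real ^ 'n ^ 'm \<Rightarrow> (int ^ 'n) set set" where
  "quasiperiodic_algebra \<Lambda> =
     {quasiperiodic_set G \<Lambda> |G.
        G \<subseteq> {u. \<forall>i. 0 \<le> u $ i \<and> u $ i < 1} \<and> jordan_measurable G}"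

end

theory Submission
  imports Defs
begin

text \<open>For a nonzero integer vector \<open>c\<close>, nonresonance makes some coordinate of \<open>c v* \<Lambda>\<close> noninteger,
  so the sum of the character \<open>exp (2 \<pi> i c \<bullet> \<Lambda> x)\<close> over a box is a product of geometric sums one
  of which stays bounded; hence box averages of nontrivial characters tend to \<open>0\<close>, uniformly in the
  position of the box. As polynomials on the torus are trigonometric polynomials,
  Stone--Weierstrass turns this into an upper bound for the density of the points with
  \<open>\<Lambda> x \<in> E\<close>, for closed periodic \<open>E\<close>. For a periodic set with null frontier, this bound
  for the closures of the set and of its complement gives the limit density.
  Almost everywhere continuity of \<open>g\<close> enters through
  \<open>frontier (g -` B) \<subseteq> {u. \<not> isCont g u} \<union> g -` frontier B\<close>.\<close>

section \<open>Averages over large boxes\<close>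

text \<open>Convergence along this filter is convergence as the shortest side grows, uniformly in
  the position and shape of the box; this is the uniformity that both frequencies demand.\<close>

definition large_boxes :: "(int ^ 'n) set filter" where
  "large_boxes = (INF N\<in>{1..}. principal (int_boxes N))"

definition box_average :: "(int ^ 'n \<Rightarrow> 'a::real_normed_vector) \<Rightarrow> (int ^ 'n) set \<Rightarrow> 'a" where
  "box_average f P = (\<Sum>x\<in>P. f x) /\<^sub>R real (card P)"

lemma int_boxes_antimono: "M \<le> N \<Longrightarrow> int_boxes N \<subseteq> int_boxes M"
  unfolding int_boxes_def by (rule Collect_mono) (metis le_trans)

lemma int_boxes_nonempty: "int_boxes N \<noteq> {}"
proof -
  have "int_box 0 (\<chi> k. max 1 N) \<in> int_boxes N"
    unfolding int_boxes_def by force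
  then show ?thesis by blast
qed

text \<open>The families \<open>int_boxes N\<close> are nested, so the infimum is directed and a
  single member of it decides.\<close>

lemma eventually_large_boxes:
  "eventually Q large_boxes \<longleftrightarrow> (\<exists>N\<ge>1. \<forall>P\<in>int_boxes N. Q P)"
proof -
  have "eventually Q large_boxes \<longleftrightarrow> (\<exists>N\<in>{1..}. eventually Q (principal (int_boxes N)))"
    unfolding large_boxes_def
  proof (rule eventually_INF_base)
    fix M N :: nat assume "M \<in> {1..}" "N \<in> {1..}"
    then show "\<exists>K\<in>{1..}. principal (int_boxes K)
        \<le> inf (principal (int_boxes M)) (principal (int_boxes N :: (int ^ 'n) set set))"
      by (intro bexI[of _ "max M N"]) (simp_all add: int_boxes_antimono)
  qed auto
  then show ?thesis by (auto simp: eventually_principal)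
qed

text \<open>A box is a finite product of integer intervals; in this form its cardinality and the
  sums over it follow from the rules for \<open>PiE\<close>.\<close>

lemma bij_betw_int_box:
  "bij_betw vec_lambda (\<Pi>\<^sub>E k\<in>UNIV. {a $ k..<a $ k + int (l $ k)}) (int_box a l)"
  by (rule bij_betw_byWitness[where f' = vec_nth])
     (auto simp: int_box_def PiE_def Pi_def extensional_def)

lemma card_int_box: "card (int_box a l) = (\<Prod>k\<in>UNIV. l $ k)"
  using bij_betw_same_card[OF bij_betw_int_box[of a l]] by (simp add: card_PiE)

lemma finite_int_box: "finite (int_box a l)"
  using bij_betw_finite[OF bij_betw_int_box[of a l]] by (simp add: finite_PiE)

text \<open>Expanding the product of sums selects one summand per coordinate, that is, one lattice
  point of the box.\<close>

lemma sum_int_box_prod: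
  fixes f :: "'n::finite \<Rightarrow> int \<Rightarrow> 'a::comm_semiring_1"
  shows "(\<Sum>x\<in>int_box a l. \<Prod>k\<in>UNIV. f k (x $ k)) = (\<Prod>k\<in>UNIV. \<Sum>j<l $ k. f k (a $ k + int j))"
proof -
  have *: "(\<Sum>j<m. h (b + int j)) = (\<Sum>j\<in>{b..<b + int m}. h j)" for b m and h :: "int \<Rightarrow> 'a"
    by (rule sum.reindex_bij_witness[of _ "\<lambda>j. nat (j - b)" "\<lambda>j. b + int j"]) auto
  show ?thesis
    unfolding * sum.reindex_bij_betw[OF bij_betw_int_box, symmetric]
    by (subst prod_sum_PiE) auto
qed

lemma int_boxes_finite_nonempty:
  assumes "P \<in> int_boxes N"
  shows "finite P" and "P \<noteq> {}"
proof -
  obtain a l where P: "P = int_box a l" "\<And>k. 1 \<le> l $ k"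
    using assms unfolding int_boxes_def by blast
  show "finite P" by (simp add: P finite_int_box)
  have "card P \<noteq> 0" using P(2) by (auto simp: P(1) card_int_box Suc_le_eq)
  then show "P \<noteq> {}" by auto
qed

lemma eventually_large_boxes_finite_nonempty:
  "eventually (\<lambda>P. finite P \<and> P \<noteq> {}) large_boxes"
  using int_boxes_finite_nonempty[where N = 1]
  by (auto simp: eventually_large_boxes simp del: One_nat_def intro!: exI[of _ "1::nat"])

lemma density_in_bounds: "0 \<le> density_in A P" "density_in A P \<le> 1"
proof -
  show "0 \<le> density_in A P" by (simp add: density_in_def)
  show "density_in A P \<le> 1"
    \<comment> \<open>For infinite \<open>P\<close> the denominator is \<open>0\<close>, and the
      quotient is \<open>0\<close> by convention.\<close>
    by (cases "finite P") (auto simp: density_in_def card_mono intro!: divide_le_eq_1[THEN iffD2])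
qed

lemma density_in_Compl:
  assumes "finite P" "P \<noteq> {}"
  shows "density_in (- A) P = 1 - density_in A P"
proof -
  have "card P = card (A \<inter> P) + card (- A \<inter> P)"
    using assms by (subst card_Un_disjoint[symmetric]) (auto intro!: arg_cong[of _ _ card])
  then have "real (card (- A \<inter> P)) = real (card P) - real (card (A \<inter> P))" by linarith
  moreover have "real (card P) \<noteq> 0" using assms by simp
  ultimately show ?thesis unfolding density_in_def by (metis diff_divide_distrib divide_self)
qed

text \<open>For every \<open>e > 0\<close> all sufficiently large boxes have density within
  \<open>e\<close> of \<open>d\<close>, which bounds \<open>lower_freq\<close> from below and
  \<open>upper_freq\<close> from above; that the first is at most the second holds for every
  set.\<close>

lemma freq_eqI:
  fixes A :: "(int ^ 'n) set"
  assumes "(density_in A \<longlongrightarrow> d) large_boxes"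
  shows "freq_measurable A" and "freq A = d"
proof -
  have bdd: "bdd_below (density_in A ` S)" "bdd_above (density_in A ` S)" for S
    using density_in_bounds by (auto intro!: bdd_belowI[of _ 0] bdd_aboveI[of _ 1])
  \<comment> \<open>A box with all sides at least \<open>max M N\<close> lies in both
    families.\<close>
  have inf_le: "(INF P\<in>int_boxes M. density_in A P) \<le> (SUP P\<in>int_boxes N. density_in A P)" for M N
  proof -
    obtain P :: "(int ^ 'n) set" where "P \<in> int_boxes (max M N)" using int_boxes_nonempty by blast
    then have "P \<in> int_boxes M" "P \<in> int_boxes N"
      using int_boxes_antimono[of M "max M N"] int_boxes_antimono[of N "max M N"] by auto
    then have "(INF P\<in>int_boxes M. density_in A P) \<le> density_in A P"
      "density_in A P \<le> (SUP P\<in>int_boxes N. density_in A P)"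
      by (auto intro: cINF_lower bdd cSUP_upper)
    then show ?thesis by linarith
  qed
  \<comment> \<open>Comparison with index \<open>1\<close> bounds the outer families, as real
    suprema and infima require.\<close>
  have bdd': "bdd_above ((\<lambda>N. INF P\<in>int_boxes N. density_in A P) ` {1..})"
    "bdd_below ((\<lambda>N. SUP P\<in>int_boxes N. density_in A P) ` {1..})"
    using inf_le[of _ 1] inf_le[of 1] by (auto simp: bdd_above_def bdd_below_def)
  have le: "lower_freq A \<le> upper_freq A"
    unfolding lower_freq_def upper_freq_def
    by (intro cSUP_least cINF_greatest inf_le) auto
  have lower: "d \<le> lower_freq A"
  proof (rule field_le_epsilon)
    fix e :: real assume "0 < e"
    then have "eventually (\<lambda>P. d - e < density_in A P) large_boxes"
      by (intro order_tendstoD[OF assms]) simp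
    then obtain N where N: "N \<ge> 1" "\<And>P. P \<in> int_boxes N \<Longrightarrow> d - e < density_in A P"
      by (auto simp: eventually_large_boxes)
    have "d - e \<le> (INF P\<in>int_boxes N. density_in A P)"
      by (intro cINF_greatest int_boxes_nonempty less_imp_le N)
    also have "\<dots> \<le> lower_freq A"
      unfolding lower_freq_def using N(1) by (intro cSUP_upper bdd') simp
    finally show "d \<le> lower_freq A + e" by simp
  qed
  have upper: "upper_freq A \<le> d"
  proof (rule field_le_epsilon)
    fix e :: real assume "0 < e"
    then have "eventually (\<lambda>P. density_in A P < d + e) large_boxes"
      by (intro order_tendstoD[OF assms]) simp
    then obtain N where N: "N \<ge> 1" "\<And>P. P \<in> int_boxes N \<Longrightarrow> density_in A P < d + e"
      by (auto simp: eventually_large_boxes)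
    have "upper_freq A \<le> (SUP P\<in>int_boxes N. density_in A P)"
      unfolding upper_freq_def using N(1) by (intro cINF_lower bdd') simp
    also have "\<dots> \<le> d + e"
      by (intro cSUP_least int_boxes_nonempty less_imp_le N)
    finally show "upper_freq A \<le> d + e" .
  qed
  show "freq_measurable A" "freq A = d"
    using le lower upper by (auto simp: freq_measurable_def freq_def)
qed

section \<open>Characters of the torus\<close>

definition character :: "int ^ 'm \<Rightarrow> real ^ 'm \<Rightarrow> complex" where
  "character c u = cis (2 * pi * (vec_of_int c \<bullet> u))"

lemma vec_of_int_add: "vec_of_int (a + b) = vec_of_int a + vec_of_int b"
  and vec_of_int_minus: "vec_of_int (- a) = - vec_of_int a"
  and vec_of_int_zero: "vec_of_int 0 = 0"
  by (simp_all add: vec_of_int_def vec_eq_iff)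

lemma character_zero: "character 0 u = 1"
  by (simp add: character_def vec_of_int_zero)

lemma character_add_index: "character (c + d) u = character c u * character d u"
  by (simp add: character_def vec_of_int_add inner_add_left distrib_left cis_mult)

lemma character_add: "character c (u + v) = character c u * character c v"
  by (simp add: character_def inner_add_right distrib_left cis_mult)

lemma character_vec_of_int: "character c (vec_of_int z) = 1"
proof -
  have "vec_of_int c \<bullet> vec_of_int z = of_int (\<Sum>i\<in>UNIV. c $ i * z $ i)"
    by (simp add: vec_of_int_def inner_vec_def)
  then show ?thesis
    unfolding character_def by (metis Ints_of_int cis_multiple_2pi)
qed

lemma unit_periodic_character: "unit_periodic (character c)"
  by (simp add: unit_periodic_def character_add character_vec_of_int)

lemma continuous_on_character: "continuous_on S (character c)"
  unfolding character_def cis_conv_exp by (intro continuous_intros)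

text \<open>The numerator of the closed form has norm at most \<open>2\<close>, so the bound does
  not depend on the number \<open>l\<close> of terms.\<close>

lemma norm_geometric_sum_cis_le:
  assumes "cis t \<noteq> 1"
  shows "norm (\<Sum>j<l. cis (s + t * real j)) \<le> 2 / norm (1 - cis t)"
proof -
  have "(\<Sum>j<l. cis (s + t * real j)) = cis s * (\<Sum>j<l. cis t ^ j)"
    by (simp add: sum_distrib_left cis_mult Complex.DeMoivre mult.commute)
  also have "\<dots> = cis s * ((1 - cis t ^ l) / (1 - cis t))"
    using assms by (simp add: sum_gp_strict)
  also have "norm \<dots> \<le> 2 / norm (1 - cis t)"
    unfolding norm_mult norm_divide norm_cis
    using norm_triangle_ineq4[of 1 "cis t ^ l"]
    by (auto simp: norm_power intro!: divide_right_mono)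
  finally show ?thesis .
qed

text \<open>Otherwise \<open>c\<close> combines the rows of \<open>\<Lambda>\<close> into an integer
  vector; subtracting that vector, written in the rows of the identity, yields a nontrivial rational
  relation.\<close>

lemma nonresonant_not_int:
  assumes "nonresonant \<Lambda>" "c \<noteq> 0"
  shows "\<exists>k. (vec_of_int c v* \<Lambda>) $ k \<notin> \<int>"
proof (rule ccontr)
  assume "\<not> ?thesis"
  then have "\<forall>k. \<exists>j. (vec_of_int c v* \<Lambda>) $ k = of_int j" by (auto elim: Ints_cases)
  then obtain b :: "'a \<Rightarrow> int" where b: "(vec_of_int c v* \<Lambda>) $ k = of_int (b k)" for k by metis
  define q :: "'a + 'b \<Rightarrow> rat" where
    "q i = (case i of Inl k \<Rightarrow> - of_int (b k) | Inr j \<Rightarrow> of_int (c $ j))" for i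
  have "(\<Sum>i\<in>UNIV. rat_scale (q i) (row i (id_stack \<Lambda>))) $ k = 0" for k
  proof -
    have "(\<Sum>i\<in>UNIV. rat_scale (q i) (row i (id_stack \<Lambda>))) $ k
        = (\<Sum>j\<in>UNIV. - of_int (b j) * (if j = k then 1 else 0)) + (\<Sum>j\<in>UNIV. of_int (c $ j) * \<Lambda> $ j $ k)"
      unfolding UNIV_Plus_UNIV[where 'a='a and 'b='b, symmetric]
      by (subst sum.Plus) (simp_all add: q_def id_stack_def row_def mat_def of_rat_minus
          sum_component sum_negf)
    also have "\<dots> = - of_int (b k) + (vec_of_int c v* \<Lambda>) $ k"
      by (simp add: vector_matrix_mult_def vec_of_int_def mult.commute if_distrib sum_negf
          cong: if_cong)
    finally show ?thesis using b by simp
  qed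
  then have "(\<Sum>i\<in>UNIV. rat_scale (q i) (row i (id_stack \<Lambda>))) = 0"
    by (simp add: vec_eq_iff)
  with assms(1) have "q (Inr j) = 0" for j
    by (simp add: nonresonant_iff)
  then have "c = 0" by (simp add: q_def vec_eq_iff)
  with assms(2) show False by simp
qed

text \<open>The average factors over the coordinates. At a coordinate \<open>k\<close> with
  \<open>\<theta> $ k\<close> not an integer the factor has norm at most \<open>C / l $ k\<close>;
  every other factor has norm at most \<open>1\<close>.\<close>

lemma box_average_character:
  fixes \<Lambda> :: "real ^ 'n ^ 'm"
  assumes "nonresonant \<Lambda>" "c \<noteq> 0"
  shows "(box_average (\<lambda>x. character c (\<Lambda> *v vec_of_int x)) \<longlongrightarrow> 0) large_boxes"
proof -
  define \<theta> where "\<theta> = vec_of_int c v* \<Lambda>"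
  obtain k where k: "\<theta> $ k \<notin> \<int>"
    using nonresonant_not_int[OF assms] unfolding \<theta>_def by blast
  have neq: "cis (2 * pi * \<theta> $ k) \<noteq> 1"
  proof
    assume "cis (2 * pi * \<theta> $ k) = 1"
    then have "cos (2 * pi * \<theta> $ k) = 1" by (simp add: complex_eq_iff)
    then obtain j :: int where "2 * pi * \<theta> $ k = j * 2 * pi" by (auto simp: cos_one_2pi_int)
    then show False using k by simp
  qed
  define C where "C = 2 / norm (1 - cis (2 * pi * \<theta> $ k))"
  have "C \<ge> 0" by (simp add: C_def)
  have char: "character c (\<Lambda> *v vec_of_int x) = (\<Prod>i\<in>UNIV. cis (2 * pi * (\<theta> $ i * real_of_int (x $ i))))"
    for x :: "int ^ 'n"
  proof -
    have "vec_of_int c \<bullet> (\<Lambda> *v vec_of_int x) = (\<Sum>i\<in>UNIV. \<theta> $ i * real_of_int (x $ i))"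
      unfolding dot_lmul_matrix[symmetric] \<theta>_def[symmetric] by (simp add: inner_vec_def vec_of_int_def)
    then show ?thesis
      by (simp add: character_def cis_conv_exp exp_sum[symmetric] sum_distrib_left sum_distrib_right)
  qed
  have bound: "norm (box_average (\<lambda>x. character c (\<Lambda> *v vec_of_int x)) P) \<le> C / real N"
    if PN: "P \<in> int_boxes N" "1 \<le> N" for P N
  proof -
    obtain a l where P: "P = int_box a l" "\<And>k. 1 \<le> l $ k" "\<And>k. N \<le> l $ k"
      using PN(1) unfolding int_boxes_def by blast
    define S where "S i = (\<Sum>j<l $ i. cis (2 * pi * (\<theta> $ i * real_of_int (a $ i + int j))))" for i
    have "norm (S i) \<le> (\<Sum>j<l $ i. 1)" for i
      unfolding S_def by (rule sum_norm_le) simp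
    then have S_le: "norm (S i) / real (l $ i) \<le> 1" for i
      by (simp add: divide_le_eq)
    have "S k = (\<Sum>j<l $ k. cis (2 * pi * \<theta> $ k * a $ k + (2 * pi * \<theta> $ k) * real j))"
      unfolding S_def by (intro sum.cong refl arg_cong[of _ _ cis]) (simp add: algebra_simps)
    then have Sk: "norm (S k) \<le> C"
      unfolding C_def using norm_geometric_sum_cis_le[OF neq] by metis
    have "(\<Sum>x\<in>P. character c (\<Lambda> *v vec_of_int x)) = (\<Prod>i\<in>UNIV. S i)"
      unfolding P(1) char S_def
      by (rule sum_int_box_prod[where f = "\<lambda>i t. cis (2 * pi * (\<theta> $ i * real_of_int t))"])
    then have "norm (box_average (\<lambda>x. character c (\<Lambda> *v vec_of_int x)) P)
        = norm (\<Prod>i\<in>UNIV. S i) / (\<Prod>i\<in>UNIV. real (l $ i))"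
      by (simp add: box_average_def P(1) card_int_box divide_inverse_commute abs_prod)
    also have "\<dots> = (\<Prod>i\<in>UNIV. norm (S i) / real (l $ i))"
      by (simp add: prod_dividef prod_norm)
    also have "\<dots> = norm (S k) / real (l $ k) * (\<Prod>i\<in>UNIV - {k}. norm (S i) / real (l $ i))"
      by (simp add: prod.remove)
    also have "\<dots> \<le> norm (S k) / real (l $ k) * 1"
      by (intro mult_left_mono prod_le_1) (auto intro: S_le)
    also have "\<dots> \<le> C / real N"
      using Sk P(2)[of k] P(3)[of k] PN(2) \<open>C \<ge> 0\<close> by (auto intro!: frac_le)
    finally show ?thesis .
  qed
  show ?thesis
  proof (rule tendstoI)
    fix e :: real assume "e > 0"
    obtain N :: nat where N: "C / e < N" using reals_Archimedean2 by blast
    have "N \<ge> 1" using N \<open>C \<ge> 0\<close> \<open>e > 0\<close> by (cases N) (auto simp: field_simps)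
    moreover have "C / real N < e" using N \<open>e > 0\<close> \<open>N \<ge> 1\<close> by (simp add: field_simps)
    ultimately have "norm (box_average (\<lambda>x. character c (\<Lambda> *v vec_of_int x)) P) < e" if "P \<in> int_boxes N" for P
      using bound[OF that] by linarith
    with \<open>N \<ge> 1\<close> show "eventually (\<lambda>P. dist (box_average (\<lambda>x. character c (\<Lambda> *v vec_of_int x)) P) 0 < e) large_boxes"
      unfolding eventually_large_boxes dist_0_norm by auto
  qed
qed

section \<open>Periodic functions on cells\<close>

text \<open>Half-open in every coordinate, so that it is a cell; it serves as the reference cell
  throughout.\<close>

definition unit_cube :: "(real ^ 'm) set" where
  "unit_cube = {u. \<forall>i. 0 \<le> u $ i \<and> u $ i < 1}"

lemma mem_translate_by: "u \<in> translate_by V z \<longleftrightarrow> u - vec_of_int z \<in> V"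
  unfolding translate_by_def by (auto intro: image_eqI[of _ _ "u - vec_of_int z"])

text \<open>Covering gives the existence of \<open>z\<close>, disjointness its uniqueness.\<close>

lemma cell_iff: "cell V \<longleftrightarrow> (\<forall>u. \<exists>!z. u - vec_of_int z \<in> V)"
proof
  assume V: "cell V"
  show "\<forall>u. \<exists>!z. u - vec_of_int z \<in> V"
  proof
    fix u
    have "u \<in> (\<Union>z. translate_by V z)" using V by (simp add: cell_def)
    then obtain z where z: "u \<in> translate_by V z" by blast
    have "z' = z" if "u \<in> translate_by V z'" for z'
      using V z that unfolding cell_def disjoint_family_on_def by blast
    with z show "\<exists>!z. u - vec_of_int z \<in> V" by (auto simp: mem_translate_by)
  qed
next
  assume V: "\<forall>u. \<exists>!z. u - vec_of_int z \<in> V"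
  then have "u \<in> (\<Union>z. translate_by V z)" for u
    unfolding UN_iff mem_translate_by by blast
  moreover have "disjoint_family (translate_by V)"
  proof (unfold disjoint_family_on_def, intro ballI impI equals0I)
    fix z z' u assume "z \<noteq> z'" "u \<in> translate_by V z \<inter> translate_by V z'"
    then show False using V unfolding Int_iff mem_translate_by by blast
  qed
  ultimately show "cell V" unfolding cell_def by blast
qed

lemma mem_translation: "x \<in> (+) t ` V \<longleftrightarrow> x - t \<in> V" for x t :: "'a::ab_group_add"
  by (auto intro: image_eqI[of _ _ "x - t"])

lemma cell_translate:
  assumes "cell V"
  shows "cell ((+) t ` V)"
proof -
  have "u - vec_of_int z \<in> (+) t ` V \<longleftrightarrow> (u - t) - vec_of_int z \<in> V" for u z
    unfolding mem_translation by (simp add: diff_diff_eq add.commute)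
  then show ?thesis using assms by (simp add: cell_iff)
qed

lemma cell_unit_cube: "cell unit_cube"
  unfolding cell_iff
proof
  fix u :: "real ^ 'm"
  have "u - vec_of_int z \<in> unit_cube \<longleftrightarrow> z = (\<chi> i. \<lfloor>u $ i\<rfloor>)" for z
  proof -
    have "u - vec_of_int z \<in> unit_cube \<longleftrightarrow> (\<forall>i. \<lfloor>u $ i\<rfloor> = z $ i)"
      by (simp add: unit_cube_def vec_of_int_def floor_eq_iff algebra_simps)
    then show ?thesis by (auto simp: vec_eq_iff)
  qed
  then show "\<exists>!z. u - vec_of_int z \<in> unit_cube" by simp
qed

lemma unit_cube_subset_cbox: "unit_cube \<subseteq> cbox 0 1"
  and box_subset_unit_cube: "box 0 1 \<subseteq> unit_cube"
  by (auto simp: unit_cube_def mem_box_cart less_imp_le)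

text \<open>The cube lies between the open and the closed box with the same corners, so its frontier
  lies in the null boundary of that box.\<close>

lemma frontier_unit_cube: "frontier unit_cube \<in> null_sets lebesgue"
proof -
  have "closure unit_cube \<subseteq> cbox 0 (1 :: real ^ 'm)"
    by (intro closure_minimal unit_cube_subset_cbox closed_cbox)
  moreover have "box 0 (1 :: real ^ 'm) \<subseteq> interior unit_cube"
    by (intro interior_maximal box_subset_unit_cube open_box)
  ultimately have "frontier unit_cube \<subseteq> cbox 0 (1 :: real ^ 'm) - box 0 1"
    unfolding frontier_def by blast
  then show ?thesis
    by (meson negligible_frontier_interval negligible_iff_null_sets negligible_subset)
qed

lemma lebesgue_measurable_unit_cube: "unit_cube \<in> sets lebesgue"
proof -
  have "unit_cube = (\<Inter>i. {u :: real ^ 'm. 0 \<le> u $ i} \<inter> {u. u $ i < 1})"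
    by (auto simp: unit_cube_def)
  also have "\<dots> \<in> sets borel"
    by (intro sets.countable_INT'' sets.Int borel_closed borel_open closed_Collect_le open_Collect_less
        continuous_intros) auto
  finally show ?thesis by auto
qed

lemma emeasure_unit_cube: "emeasure lebesgue (unit_cube :: (real ^ 'm) set) = 1"
proof (rule antisym)
  have one: "(1 :: real ^ 'm) \<bullet> b = 1" if "b \<in> Basis" for b
    using that by (auto simp: Basis_vec_def inner_axis)
  have "emeasure lborel (cbox 0 (1 :: real ^ 'm)) = 1"
    by (subst emeasure_lborel_cbox_eq) (auto simp: one)
  then have cbox: "emeasure lebesgue (cbox 0 (1 :: real ^ 'm)) = 1" by simp
  have "emeasure lborel (box 0 (1 :: real ^ 'm)) = 1"
    by (subst emeasure_lborel_box_eq) (auto simp: one)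
  then have box: "emeasure lebesgue (box 0 (1 :: real ^ 'm)) = 1" by simp
  show "emeasure lebesgue (unit_cube :: (real ^ 'm) set) \<le> 1"
    unfolding cbox[symmetric] by (intro emeasure_mono unit_cube_subset_cbox) simp
  show "1 \<le> emeasure lebesgue (unit_cube :: (real ^ 'm) set)"
    unfolding box[symmetric]
    by (intro emeasure_mono box_subset_unit_cube lebesgue_measurable_unit_cube)
qed

section \<open>Independence of the choice of cell\<close>

lemma emeasure_lebesgue_translate: "emeasure lebesgue ((+) t ` S) = emeasure lebesgue S"
  using emeasure_lebesgue_affine[of 1 t S] by (simp add: add.commute[of t])

text \<open>Cut \<open>V\<close> along the translates of \<open>W\<close> and move the pieces back into \<open>W\<close>.\<close>
lemma emeasure_cell_Int_eq:
  fixes V W E :: "(real ^ 'm) set"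
  assumes "cell V" "cell W" and [measurable]: "V \<in> sets lebesgue" "W \<in> sets lebesgue" "E \<in> sets lebesgue"
    and E: "\<And>u z. u + vec_of_int z \<in> E \<longleftrightarrow> u \<in> E"
  shows "emeasure lebesgue (V \<inter> E) = emeasure lebesgue (W \<inter> E)"
proof -
  have tr: "translate_by S z = (+) (vec_of_int z) ` S" for S :: "(real ^ 'm) set" and z
    by (simp add: translate_by_def add.commute)
  have tr_sets[measurable]: "translate_by S z \<in> sets lebesgue" if "S \<in> sets lebesgue"
    for S :: "(real ^ 'm) set" and z
    using that by (simp add: tr lebesgue_sets_translation)
  \<comment> \<open>The countable sum over integer vectors is written as an integral over counting
    measure.\<close>
  have split: "emeasure lebesgue (S \<inter> E) = (\<integral>\<^sup>+z. emeasure lebesgue (S \<inter> E \<inter> translate_by T z) \<partial>count_space UNIV)"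
    if "cell T" and [measurable]: "S \<in> sets lebesgue" "T \<in> sets lebesgue" for S T
  proof -
    have "S \<inter> E = (\<Union>z. S \<inter> E \<inter> translate_by T z)"
      using that(1) unfolding cell_def by blast
    then have "emeasure lebesgue (S \<inter> E) = emeasure lebesgue (\<Union>z. S \<inter> E \<inter> translate_by T z)" by simp
    also have "\<dots> = (\<integral>\<^sup>+z. emeasure lebesgue (S \<inter> E \<inter> translate_by T z) \<partial>count_space UNIV)"
      using that(1) by (intro emeasure_UN_countable) (auto simp: cell_def disjoint_family_on_def)
    finally show ?thesis .
  qed
  \<comment> \<open>The part of \<open>V\<close> in the translate of \<open>W\<close> by
    \<open>z\<close>, moved by \<open>- z\<close>, is the part of \<open>W\<close> in the translate
    of \<open>V\<close> by \<open>- z\<close>; the periodic set \<open>E\<close> is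
    preserved.\<close>
  have swap: "emeasure lebesgue (V \<inter> E \<inter> translate_by W z) = emeasure lebesgue (W \<inter> E \<inter> translate_by V (- z))" for z
  proof -
    have "V \<inter> E \<inter> translate_by W z = translate_by (W \<inter> E \<inter> translate_by V (- z)) z"
      (is "?L = ?R")
    proof (rule set_eqI)
      fix u show "u \<in> ?L \<longleftrightarrow> u \<in> ?R"
        using E[of "u - vec_of_int z" z] unfolding mem_translate_by Int_iff vec_of_int_minus by auto
    qed
    then show ?thesis by (simp add: tr emeasure_lebesgue_translate)
  qed
  have "emeasure lebesgue (V \<inter> E) = (\<integral>\<^sup>+z. emeasure lebesgue (W \<inter> E \<inter> translate_by V (- z)) \<partial>count_space UNIV)"
    using assms by (subst split[of W]) (simp_all add: swap)
  also have "\<dots> = (\<integral>\<^sup>+z. emeasure lebesgue (W \<inter> E \<inter> translate_by V z) \<partial>count_space UNIV)"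
    by (rule nn_integral_bij_count_space) (rule bij_uminus)
  also have "\<dots> = emeasure lebesgue (W \<inter> E)"
    using assms by (subst split[of V]) simp_all
  finally show ?thesis .
qed

lemma emeasure_distr_lebesgue_on:
  assumes "V \<in> sets lebesgue" "g \<in> measurable lebesgue N" "B \<in> sets N"
  shows "emeasure (distr (lebesgue_on V) N g) B = emeasure lebesgue (V \<inter> g -` B)"
proof -
  have "g \<in> measurable (lebesgue_on V) N"
    using assms(2) by (rule measurable_restrict_space1)
  then show ?thesis
    using assms by (simp add: emeasure_distr emeasure_restrict_space space_restrict_space Int_commute)
qed

text \<open>Preimages under a periodic map are periodic sets, and these have the same measure in
  every measurable cell.\<close>

lemma distr_cell_eq:
  assumes "cell V" "cell W" "V \<in> sets lebesgue" "W \<in> sets lebesgue"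
    and "unit_periodic g" and g: "g \<in> measurable lebesgue N"
  shows "distr (lebesgue_on V) N g = distr (lebesgue_on W) N g"
proof (rule measure_eqI)
  fix B assume "B \<in> sets (distr (lebesgue_on V) N g)"
  then have B: "B \<in> sets N" by simp
  have "g -` B \<in> sets lebesgue" using measurable_sets[OF g B] by simp
  then have "emeasure lebesgue (V \<inter> g -` B) = emeasure lebesgue (W \<inter> g -` B)"
    using assms(5) by (intro emeasure_cell_Int_eq[OF assms(1-4)]) (simp_all add: unit_periodic_def)
  then show "emeasure (distr (lebesgue_on V) N g) B = emeasure (distr (lebesgue_on W) N g) B"
    using assms B by (simp add: emeasure_distr_lebesgue_on)
qed simp

lemma measurable_lebesgue_translate:
  assumes "g \<in> measurable lebesgue N"
  shows "(\<lambda>u. g (t + u)) \<in> measurable lebesgue N"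
proof (rule measurableI)
  show "g (t + u) \<in> space N" for u using measurable_space[OF assms] by simp
  fix B assume "B \<in> sets N"
  then have "(+) (- t) ` (g -` B) \<in> sets lebesgue"
    using measurable_sets[OF assms] by (intro lebesgue_sets_translation) simp
  moreover have "(+) (- t) ` (g -` B) = (\<lambda>u. g (t + u)) -` B"
    unfolding set_eq_iff mem_translation by (simp add: add.commute)
  ultimately show "(\<lambda>u. g (t + u)) -` B \<inter> space lebesgue \<in> sets lebesgue" by simp
qed

lemma distr_translate:
  assumes "V \<in> sets lebesgue" and g: "g \<in> measurable lebesgue N"
  shows "distr (lebesgue_on ((+) t ` V)) N g = distr (lebesgue_on V) N (\<lambda>u. g (t + u))"
proof (rule measure_eqI)
  fix B assume "B \<in> sets (distr (lebesgue_on ((+) t ` V)) N g)"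
  then have B: "B \<in> sets N" by simp
  have "(+) t ` V \<inter> g -` B = (+) t ` (V \<inter> (\<lambda>u. g (t + u)) -` B)" by auto
  then show "emeasure (distr (lebesgue_on ((+) t ` V)) N g) B
      = emeasure (distr (lebesgue_on V) N (\<lambda>u. g (t + u))) B"
    using assms B by (simp add: emeasure_distr_lebesgue_on measurable_lebesgue_translate
        lebesgue_sets_translation emeasure_lebesgue_translate)
qed simp

section \<open>Integrals over the unit cube\<close>

lemma integral_character:
  assumes "c \<noteq> 0"
  shows "(LINT u|lebesgue_on unit_cube. character c u) = 0"
proof -
  obtain i where i: "c $ i \<noteq> 0" using assms by (auto simp: vec_eq_iff)
  \<comment> \<open>The vector \<open>t\<close> has inner product \<open>1 / 2\<close> with
    \<open>c\<close>, so translation by \<open>t\<close> flips the sign of the character. The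
    translated cube is again a cell, so the integral is unchanged and equals its own
    negative.\<close>
  define t :: "real ^ 'a" where "t = axis i (1 / (2 * real_of_int (c $ i)))"
  have t: "character c t = -1"
    using i by (simp add: character_def t_def inner_axis vec_of_int_def)
  have meas: "character c \<in> borel_measurable lebesgue"
    using continuous_on_character[of UNIV c]
    by (metis borel_measurable_continuous_onI measurable_completion measurable_lborel2)
  note [simp] = lebesgue_measurable_unit_cube
  \<comment> \<open>Written through the distribution of the character, the integral can be moved
    from one cell to another.\<close>
  have "(LINT u|lebesgue_on unit_cube. character c u)
      = integral\<^sup>L (distr (lebesgue_on unit_cube) borel (character c)) (\<lambda>w. w)"
    using meas by (subst integral_distr) (auto intro: measurable_restrict_space1)
  also have "distr (lebesgue_on unit_cube) borel (character c)
      = distr (lebesgue_on ((+) t ` unit_cube)) borel (character c)"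
    using meas by (intro distr_cell_eq cell_translate cell_unit_cube unit_periodic_character
        lebesgue_sets_translation) auto
  also have "\<dots> = distr (lebesgue_on unit_cube) borel (\<lambda>u. character c (t + u))"
    using meas by (intro distr_translate) auto
  also have "(\<lambda>u. character c (t + u)) = (\<lambda>u. - character c u)"
    by (simp add: character_add t)
  also have "integral\<^sup>L (distr (lebesgue_on unit_cube) borel (\<lambda>u. - character c u)) (\<lambda>w. w)
      = - (LINT u|lebesgue_on unit_cube. character c u)"
    using meas by (subst integral_distr) (auto intro: measurable_restrict_space1)
  finally show ?thesis by simp
qed

text \<open>A continuous function is bounded on the closed cube, and the unit cube has finite
  measure.\<close>

lemma integrable_on_unit_cube:
  fixes f :: "real ^ 'm \<Rightarrow> 'b::{banach, second_countable_topology}"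
  assumes "continuous_on UNIV f"
  shows "integrable (lebesgue_on unit_cube) f"
proof -
  interpret finite_measure "lebesgue_on unit_cube :: (real ^ 'm) measure"
    by standard (simp add: emeasure_restrict_space lebesgue_measurable_unit_cube emeasure_unit_cube
        space_restrict_space)
  have "compact (f ` cbox 0 1)"
    using assms by (intro compact_continuous_image) (auto intro: continuous_on_subset)
  then obtain C where C: "\<And>u. u \<in> cbox 0 1 \<Longrightarrow> norm (f u) \<le> C"
    by (meson compact_imp_bounded bounded_iff imageI)
  have "f \<in> borel_measurable lebesgue"
    using assms by (metis borel_measurable_continuous_onI measurable_completion measurable_lborel2)
  then show ?thesis
    using unit_cube_subset_cbox
    by (intro integrable_const_bound[of _ C] AE_I2 measurable_restrict_space1)
       (auto simp: space_restrict_space intro!: C)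
qed

lemma measure_lebesgue_on_unit_cube: "measure (lebesgue_on unit_cube) unit_cube = 1"
  by (simp add: measure_def emeasure_restrict_space lebesgue_measurable_unit_cube emeasure_unit_cube)

section \<open>Trigonometric polynomials\<close>

text \<open>Functions rather than coefficient families: closure under sums and products and an
  induction over monomials suffice. Constants are multiples of the character with index
  \<open>0\<close>.\<close>

inductive trig_poly :: "(real ^ 'm \<Rightarrow> complex) \<Rightarrow> bool" where
  monom: "trig_poly (\<lambda>u. a * character c u)"
| add: "trig_poly f \<Longrightarrow> trig_poly g \<Longrightarrow> trig_poly (\<lambda>u. f u + g u)"

lemma trig_poly_const: "trig_poly (\<lambda>u. a)"
  using trig_poly.monom[of a 0] by (simp add: character_zero)

lemma trig_poly_sum:
  assumes "finite I" "\<And>i. i \<in> I \<Longrightarrow> trig_poly (f i)"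
  shows "trig_poly (\<lambda>u. \<Sum>i\<in>I. f i u)"
  using assms by induction (auto intro: trig_poly_const trig_poly.add)

text \<open>Distributivity reduces both factors to monomials, and characters multiply by adding
  their indices.\<close>

lemma trig_poly_mult:
  assumes "trig_poly f" "trig_poly g"
  shows "trig_poly (\<lambda>u. f u * g u)"
  using assms
proof (induction f rule: trig_poly.induct)
  case (monom a c)
  from monom show ?case
  proof (induction g rule: trig_poly.induct)
    case (monom b d)
    show ?case
      using trig_poly.monom[of "a * b" "c + d"] by (simp add: character_add_index mult_ac)
  next
    case (add g h)
    then show ?case by (auto simp: distrib_left intro: trig_poly.add)
  qed
next
  case (add f h)
  then show ?case by (auto simp: distrib_right intro: trig_poly.add)
qed

lemma continuous_on_trig_poly: "trig_poly f \<Longrightarrow> continuous_on S f"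
  by (induction rule: trig_poly.induct) (auto intro!: continuous_intros continuous_on_character)

text \<open>Averages and integrals are additive, so monomials suffice: for a character both the
  limit and the integral are \<open>1\<close> at index \<open>0\<close> and \<open>0\<close> at
  every other index.\<close>

lemma box_average_trig_poly:
  fixes \<Lambda> :: "real ^ 'n ^ 'm"
  assumes "nonresonant \<Lambda>" "trig_poly f"
  shows "(box_average (\<lambda>x. f (\<Lambda> *v vec_of_int x)) \<longlongrightarrow> (LINT u|lebesgue_on unit_cube. f u)) large_boxes"
  using assms(2)
proof induction
  case (monom a c)
  show ?case
  proof (cases "c = 0")
    case True
    have "eventually (\<lambda>P. box_average (\<lambda>x :: int ^ 'n. a) P = a) large_boxes"
      using eventually_large_boxes_finite_nonempty
      by eventually_elim (simp add: box_average_def scaleR_conv_of_real)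
    then have "(box_average (\<lambda>x :: int ^ 'n. a) \<longlongrightarrow> a) large_boxes"
      by (rule tendsto_eventually)
    then show ?thesis
      by (simp add: True character_zero space_restrict_space measure_lebesgue_on_unit_cube)
  next
    case False
    have "((\<lambda>P. a * box_average (\<lambda>x. character c (\<Lambda> *v vec_of_int x)) P) \<longlongrightarrow> a * 0) large_boxes"
      by (intro tendsto_intros box_average_character assms(1) False)
    then show ?thesis
      by (simp add: box_average_def sum_distrib_left[symmetric] integral_character False)
  qed
next
  case (add f g)
  then show ?case
    using tendsto_add[OF add.IH]
    by (simp add: box_average_def sum.distrib scaleR_add_right
        integrable_on_unit_cube continuous_on_trig_poly)
qed

section \<open>The torus as a compact set in complex space\<close>

definition torus_map :: "real ^ 'm \<Rightarrow> complex ^ 'm" where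
  "torus_map u = (\<chi> i. cis (2 * pi * u $ i))"

text \<open>Each coordinate determines its argument up to an integer, and these integers are
  collected into one vector. Thus the image is a copy of the torus, and periodic sets are preimages
  of its subsets.\<close>

lemma torus_map_eq_iff: "torus_map u = torus_map v \<longleftrightarrow> (\<exists>z. u = v + vec_of_int z)"
proof -
  have "cis (2 * pi * u $ i) = cis (2 * pi * v $ i) \<longleftrightarrow> (\<exists>n::int. u $ i = v $ i + real_of_int n)" for i
  proof -
    have "cis (2 * pi * u $ i) = cis (2 * pi * v $ i) \<longleftrightarrow>
        (\<exists>n::int. 2 * pi * u $ i = 2 * pi * v $ i + 2 * pi * n)"
      using sin_cos_eq_iff[of "2 * pi * u $ i" "2 * pi * v $ i"] by (auto simp: complex_eq_iff)
    also have "\<dots> \<longleftrightarrow> (\<exists>n::int. u $ i = v $ i + real_of_int n)"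
      by (simp flip: distrib_left)
    finally show ?thesis .
  qed
  then have "torus_map u = torus_map v \<longleftrightarrow> (\<forall>i. \<exists>n::int. u $ i = v $ i + real_of_int n)"
    by (simp add: torus_map_def vec_eq_iff)
  also have "\<dots> \<longleftrightarrow> (\<exists>z :: int ^ 'a. \<forall>i. u $ i = v $ i + real_of_int (z $ i))"
    unfolding choice_iff by (metis vec_lambda_beta)
  finally show ?thesis by (simp add: vec_eq_iff vec_of_int_def)
qed

lemma continuous_on_torus_map: "continuous_on S torus_map"
  unfolding torus_map_def cis_conv_exp by (intro continuous_intros)

text \<open>Constants, sums and products are covered by closure properties; only real-linear forms
  in the cosines and sines of the coordinates need a computation.\<close>

lemma trig_poly_real_polynomial:
  fixes p :: "complex ^ 'm \<Rightarrow> real"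
  assumes "real_polynomial_function p"
  shows "trig_poly (\<lambda>u. of_real (p (torus_map u)))"
  using assms
proof induction
  case (linear p)
  interpret p: bounded_linear p by fact
  \<comment> \<open>With \<open>w = cis t\<close>, substitute \<open>cos t = (w + 1 / w) / 2\<close>
    and \<open>sin t = (w - 1 / w) / (2 * \<i>)\<close>; the coefficients of \<open>w\<close> and
    \<open>1 / w\<close> are \<open>\<alpha> i\<close> and \<open>\<beta> i\<close>.\<close>
  define \<alpha> \<beta> where "\<alpha> i = of_real (p (axis i 1)) / 2 - \<i> * of_real (p (axis i \<i>)) / 2"
    and "\<beta> i = of_real (p (axis i 1)) / 2 + \<i> * of_real (p (axis i \<i>)) / 2" for i
  have "of_real (p (torus_map u))
      = (\<Sum>i\<in>UNIV. \<alpha> i * character (axis i 1) u + \<beta> i * character (axis i (- 1)) u)" for u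
  proof -
    have "torus_map u
        = (\<Sum>i\<in>UNIV. cos (2 * pi * u $ i) *\<^sub>R axis i 1 + sin (2 * pi * u $ i) *\<^sub>R axis i \<i>)"
      by (simp add: vec_eq_iff torus_map_def axis_def sum.distrib complex_eq_iff if_distrib
          if_distribR cong: if_cong)
    then have "p (torus_map u)
        = (\<Sum>i\<in>UNIV. cos (2 * pi * u $ i) * p (axis i 1) + sin (2 * pi * u $ i) * p (axis i \<i>))"
      by (simp add: p.sum p.add p.scaleR)
    moreover have "character (axis i 1) u = cis (2 * pi * u $ i)"
      "character (axis i (- 1)) u = cis (- (2 * pi * u $ i))" for i
    proof -
      have "vec_of_int (axis i k) = axis i (real_of_int k)" for k
        by (simp add: vec_of_int_def axis_def vec_eq_iff)
      then show "character (axis i 1) u = cis (2 * pi * u $ i)"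
        "character (axis i (- 1)) u = cis (- (2 * pi * u $ i))"
        by (simp_all add: character_def inner_axis')
    qed
    then have "\<alpha> i * character (axis i 1) u + \<beta> i * character (axis i (- 1)) u
        = of_real (cos (2 * pi * u $ i) * p (axis i 1) + sin (2 * pi * u $ i) * p (axis i \<i>))" for i
      by (simp add: \<alpha>_def \<beta>_def complex_eq_iff field_simps)
    ultimately show ?thesis by simp
  qed
  moreover have "trig_poly (\<lambda>u. \<Sum>i\<in>UNIV. \<alpha> i * character (axis i 1) u + \<beta> i * character (axis i (- 1)) u)"
    by (intro trig_poly_sum trig_poly.intros) simp
  ultimately show ?case by simp
qed (auto intro: trig_poly_const trig_poly.add trig_poly_mult)

text \<open>The embedding of the reals into the complex numbers commutes with averages and integrals
  and reflects limits.\<close>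

lemma box_average_torus_polynomial:
  fixes \<Lambda> :: "real ^ 'n ^ 'm"
  assumes "nonresonant \<Lambda>" "real_polynomial_function p"
  shows "(box_average (\<lambda>x. p (torus_map (\<Lambda> *v vec_of_int x))) \<longlongrightarrow>
    (LINT u|lebesgue_on unit_cube. p (torus_map u))) large_boxes"
proof -
  have "box_average (\<lambda>x. complex_of_real (f x)) = (\<lambda>P. of_real (box_average f P))" for f :: "int ^ 'n \<Rightarrow> real"
    by (simp add: box_average_def scaleR_conv_of_real fun_eq_iff)
  then have "((\<lambda>P. complex_of_real (box_average (\<lambda>x. p (torus_map (\<Lambda> *v vec_of_int x))) P)) \<longlongrightarrow>
      complex_of_real (LINT u|lebesgue_on unit_cube. p (torus_map u))) large_boxes"
    using box_average_trig_poly[OF assms(1) trig_poly_real_polynomial[OF assms(2)]]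
    by (simp add: integral_complex_of_real)
  then show ?thesis by (simp add: tendsto_of_real_iff)
qed

section \<open>Equidistribution for Jordan measurable periodic sets\<close>

text \<open>By periodicity the whole image is attained on the part of \<open>E\<close> in the closed
  unit cube, which is compact.\<close>

lemma closed_torus_image:
  assumes "closed E" "\<And>u z. u + vec_of_int z \<in> E \<longleftrightarrow> u \<in> E"
  shows "closed (torus_map ` E)"
proof -
  have "torus_map u \<in> torus_map ` (E \<inter> cbox 0 1)" if "u \<in> E" for u
  proof -
    obtain z where z: "u - vec_of_int z \<in> unit_cube"
      using cell_unit_cube unfolding cell_iff by blast
    have "u - vec_of_int z \<in> E" using assms(2)[of "u - vec_of_int z" z] that by simp
    moreover have "torus_map u = torus_map (u - vec_of_int z)"
      unfolding torus_map_eq_iff by (rule exI[of _ z]) simp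
    ultimately show ?thesis using z unit_cube_subset_cbox by blast
  qed
  then have "torus_map ` E = torus_map ` (E \<inter> cbox 0 1)" by blast
  moreover have "compact (torus_map ` (E \<inter> cbox 0 1))"
    using assms(1) by (intro compact_continuous_image continuous_on_torus_map) (auto simp: closed_Int_compact)
  ultimately show ?thesis by (simp add: compact_imp_closed)
qed

lemma integral_indicator_unit_cube:
  assumes "E \<in> sets lebesgue"
  shows "(LINT u|lebesgue_on unit_cube. indicator E u) = measure lebesgue (unit_cube \<inter> E)"
  using assms by (simp add: space_restrict_space measure_restrict_space lebesgue_measurable_unit_cube
      Int_commute)

text \<open>The functions \<open>F k\<close> decrease to the indicator function of the image of \<open>E\<close> on the torus;
  by Stone--Weierstrass each of them is uniformly close to a polynomial.\<close>
lemma eventually_density_less: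
  fixes \<Lambda> :: "real ^ 'n ^ 'm"
  assumes "nonresonant \<Lambda>" and E: "closed E" "\<And>u z. u + vec_of_int z \<in> E \<longleftrightarrow> u \<in> E"
    and c: "measure lebesgue (unit_cube \<inter> E) < c"
  shows "eventually (\<lambda>P. density_in {x. \<Lambda> *v vec_of_int x \<in> E} P < c) large_boxes"
\<comment> \<open>The cutoffs below need a nonempty set, since \<open>infdist z {}\<close> is
  \<open>0\<close> by convention.\<close>
proof (cases "E = {}")
  case True
  then show ?thesis using c by (simp add: density_in_def)
next
  case False
  define A where "A = {x. \<Lambda> *v vec_of_int x \<in> E}"
  define K where "K = torus_map ` E"
  have K: "closed K" "K \<noteq> {}"
    using closed_torus_image[OF E] False by (auto simp: K_def)
  \<comment> \<open>Periodicity makes \<open>E\<close> the full preimage of its image.\<close>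
  have mem_K: "torus_map u \<in> K \<longleftrightarrow> u \<in> E" for u
    using E(2) by (auto simp: K_def torus_map_eq_iff)
  \<comment> \<open>A cutoff with value \<open>1\<close> on \<open>K\<close> that vanishes at
    distance at least \<open>1 / k\<close> from \<open>K\<close> for positive \<open>k\<close>; as
    \<open>K\<close> is closed, every point outside is eventually cut off.\<close>
  define F where "F k z = max 0 (1 - real k * infdist z K)" for k z
  have contF: "continuous_on S (F k)" for S k
    unfolding F_def by (intro continuous_intros)
  have contF': "continuous_on S (\<lambda>u. F k (torus_map u))" for S k
    by (rule continuous_on_compose2[OF contF continuous_on_torus_map]) auto
  have F_bounds: "0 \<le> F k z" "F k z \<le> 1" for k z
    by (auto simp: F_def infdist_nonneg)
  have F_ge: "indicator E u \<le> F k (torus_map u)" for k u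
    using mem_K[of u] K by (auto simp: F_def indicator_def)
  have F_lim: "(\<lambda>k. F k (torus_map u)) \<longlonglongrightarrow> indicator E u" for u
  proof (cases "u \<in> E")
    case True
    then show ?thesis using mem_K[of u] by (simp add: F_def)
  next
    case False
    then have pos: "infdist (torus_map u) K > 0"
      using K mem_K[of u] by (metis in_closed_iff_infdist_zero infdist_nonneg less_eq_real_def)
    obtain k0 :: nat where k0: "1 / infdist (torus_map u) K < k0" using reals_Archimedean2 by blast
    have "F k (torus_map u) = 0" if "k \<ge> k0" for k
    proof -
      have "1 \<le> real k0 * infdist (torus_map u) K" using k0 pos by (simp add: field_simps)
      also have "\<dots> \<le> real k * infdist (torus_map u) K"
        using that pos by (intro mult_right_mono) auto
      finally show ?thesis by (simp add: F_def)
    qed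
    then show ?thesis using False
      by (intro tendsto_eventually) (auto simp: eventually_sequentially)
  qed
  have "E \<in> sets lebesgue" using E(1) by auto
  have "(\<lambda>k. LINT u|lebesgue_on unit_cube. F k (torus_map u)) \<longlonglongrightarrow>
      (LINT u|lebesgue_on unit_cube. indicator E u)"
  proof (rule integral_dominated_convergence[where w = "\<lambda>_. 1"])
    show "indicator E \<in> borel_measurable (lebesgue_on unit_cube)"
      using \<open>E \<in> sets lebesgue\<close> by (intro measurable_restrict_space1) auto
    show "integrable (lebesgue_on unit_cube) (\<lambda>_. 1 :: real)"
      by (intro integrable_on_unit_cube) simp
    show "(\<lambda>u. F k (torus_map u)) \<in> borel_measurable (lebesgue_on unit_cube)" for k
      by (intro borel_measurable_integrable integrable_on_unit_cube contF')
  qed (auto simp: F_lim F_bounds)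
  then have lim: "(\<lambda>k. LINT u|lebesgue_on unit_cube. F k (torus_map u)) \<longlonglongrightarrow> measure lebesgue (unit_cube \<inter> E)"
    unfolding integral_indicator_unit_cube[OF \<open>E \<in> sets lebesgue\<close>] .
  \<comment> \<open>One \<open>\<delta>\<close> is spent on the choice of \<open>k\<close>, one on
    the integral of the polynomial and one on its box average; the fourth is slack.\<close>
  define \<delta> where "\<delta> = (c - measure lebesgue (unit_cube \<inter> E)) / 4"
  have \<delta>: "\<delta> > 0" "measure lebesgue (unit_cube \<inter> E) + 4 * \<delta> = c"
    using c by (simp_all add: \<delta>_def field_simps)
  obtain k where k: "(LINT u|lebesgue_on unit_cube. F k (torus_map u)) < measure lebesgue (unit_cube \<inter> E) + \<delta>"
    using order_tendstoD(2)[OF lim, of "measure lebesgue (unit_cube \<inter> E) + \<delta>"] \<delta>(1)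
    by (auto simp: eventually_sequentially)
  \<comment> \<open>Stone--Weierstrass is applied on the whole torus, so that the approximation
    holds at every orbit point.\<close>
  have "compact (range (torus_map :: real ^ 'm \<Rightarrow> complex ^ 'm))"
  proof -
    have "closed (range (torus_map :: real ^ 'm \<Rightarrow> complex ^ 'm))"
      by (rule closed_torus_image) auto
    moreover have "bounded (range (torus_map :: real ^ 'm \<Rightarrow> complex ^ 'm))"
    proof (rule boundedI)
      fix z assume "z \<in> range (torus_map :: real ^ 'm \<Rightarrow> complex ^ 'm)"
      then show "norm z \<le> (\<Sum>i\<in>(UNIV :: 'm set). 1)"
        using norm_le_l1_cart
        by (auto simp: torus_map_def norm_vec_def intro!: order_trans[OF L2_set_le_sum])
    qed
    ultimately show ?thesis by (simp add: compact_eq_bounded_closed)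
  qed
  then obtain p where p: "real_polynomial_function p"
    "\<And>z. z \<in> range torus_map \<Longrightarrow> \<bar>F k z - p z\<bar> < \<delta>"
    using Stone_Weierstrass_real_polynomial_function[OF _ contF \<delta>(1)] by metis
  have contp: "continuous_on UNIV (\<lambda>u. p (torus_map u))"
    using continuous_on_compose2[OF continuous_on_polymonial_function[OF p(1)[unfolded real_polynomial_function_eq]]
        continuous_on_torus_map] by auto
  have p_near: "\<bar>F k (torus_map u) - p (torus_map u)\<bar> < \<delta>" for u
    by (rule p(2)) simp
  have "(LINT u|lebesgue_on unit_cube. p (torus_map u))
      \<le> (LINT u|lebesgue_on unit_cube. F k (torus_map u) + \<delta>)"
  proof (intro integral_mono integrable_on_unit_cube contp)
    show "continuous_on UNIV (\<lambda>u. F k (torus_map u) + \<delta>)" by (intro continuous_intros contF')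
    show "p (torus_map u) \<le> F k (torus_map u) + \<delta>" for u using p_near[of u] by linarith
  qed
  also have "\<dots> = (LINT u|lebesgue_on unit_cube. F k (torus_map u)) + \<delta>"
    by (simp add: integrable_on_unit_cube contF' space_restrict_space measure_lebesgue_on_unit_cube)
  finally have "(LINT u|lebesgue_on unit_cube. p (torus_map u)) < c - \<delta>"
    using k \<delta> by linarith
  then have "eventually (\<lambda>P. box_average (\<lambda>x. p (torus_map (\<Lambda> *v vec_of_int x))) P < c - \<delta>) large_boxes"
    by (rule order_tendstoD[OF box_average_torus_polynomial[OF assms(1) p(1)]])
  then show ?thesis
    using eventually_large_boxes_finite_nonempty
  proof eventually_elim
    case (elim P)
    then have P: "real (card P) > 0" by (simp add: card_gt_0_iff)
    have "real (card (A \<inter> P)) = (\<Sum>x\<in>P. indicator A x)"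
      using elim by (simp add: indicator_def sum.If_cases Int_commute)
    \<comment> \<open>Pointwise, the indicator is at most \<open>F k\<close>, which is at most the
      polynomial plus \<open>\<delta>\<close>.\<close>
    also have "\<dots> \<le> (\<Sum>x\<in>P. p (torus_map (\<Lambda> *v vec_of_int x)) + \<delta>)"
    proof (rule sum_mono)
      fix x
      have "indicator A x = (indicator E (\<Lambda> *v vec_of_int x) :: real)"
        by (simp add: A_def indicator_def)
      then show "indicator A x \<le> p (torus_map (\<Lambda> *v vec_of_int x)) + \<delta>"
        using F_ge[of "\<Lambda> *v vec_of_int x" k] p_near[of "\<Lambda> *v vec_of_int x"] by linarith
    qed
    finally have "density_in A P \<le> box_average (\<lambda>x. p (torus_map (\<Lambda> *v vec_of_int x))) P + \<delta>"
      using P by (simp add: density_in_def box_average_def sum.distrib field_simps)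
    then show ?case using elim by (simp add: A_def)
  qed
qed

text \<open>The set is its open interior together with a subset of the null frontier; Lebesgue
  measure is complete.\<close>

lemma lebesgue_measurable_if_frontier_null:
  fixes E :: "'a::euclidean_space set"
  assumes "frontier E \<in> null_sets lebesgue"
  shows "E \<in> sets lebesgue"
proof -
  have "E - interior E \<subseteq> frontier E" using closure_subset by (auto simp: frontier_def)
  then have "E - interior E \<in> sets lebesgue"
    using assms by (metis negligible_iff_null_sets negligible_subset null_setsD2)
  then have "interior E \<union> (E - interior E) \<in> sets lebesgue" by (intro sets.Un) auto
  then show ?thesis by (metis Un_Diff_cancel Un_absorb1 interior_subset)
qed

lemma density_tendsto:
  fixes \<Lambda> :: "real ^ 'n ^ 'm"
  assumes "nonresonant \<Lambda>" and per: "\<And>u z. u + vec_of_int z \<in> E \<longleftrightarrow> u \<in> E"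
    and null: "frontier E \<in> null_sets lebesgue"
  shows "(density_in {x. \<Lambda> *v vec_of_int x \<in> E} \<longlongrightarrow> measure lebesgue (unit_cube \<inter> E)) large_boxes"
proof -
  \<comment> \<open>Passing to the closure adds only part of the null frontier to the measure and
    can only increase the density.\<close>
  have upper: "eventually (\<lambda>P. density_in {x. \<Lambda> *v vec_of_int x \<in> S} P < c) large_boxes"
    if S: "\<And>u z. u + vec_of_int z \<in> S \<longleftrightarrow> u \<in> S" "frontier S \<in> null_sets lebesgue"
      and c: "measure lebesgue (unit_cube \<inter> S) < c" for S c
  proof -
    have S_sets: "S \<in> sets lebesgue" using S(2) by (rule lebesgue_measurable_if_frontier_null)
    have "closure S - S \<subseteq> frontier S" using interior_subset by (auto simp: frontier_def)
    then have "unit_cube \<inter> (closure S - S) \<in> null_sets lebesgue"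
      using S(2) by (metis negligible_iff_null_sets negligible_subset negligible_Int)
    then have "emeasure lebesgue (unit_cube \<inter> S \<union> unit_cube \<inter> (closure S - S)) = emeasure lebesgue (unit_cube \<inter> S)"
      using S_sets lebesgue_measurable_unit_cube by (intro emeasure_Un_null_set sets.Int)
    moreover have "unit_cube \<inter> S \<union> unit_cube \<inter> (closure S - S) = unit_cube \<inter> closure S"
      using closure_subset by blast
    ultimately have "measure lebesgue (unit_cube \<inter> closure S) < c"
      using c by (simp add: measure_def)
    \<comment> \<open>Closure commutes with translations, so it inherits periodicity.\<close>
    moreover have "u + vec_of_int z \<in> closure S \<longleftrightarrow> u \<in> closure S" for u z
    proof -
      have "(+) (vec_of_int z) ` S = S"
        using S(1)[of "_ - vec_of_int z" z] unfolding set_eq_iff mem_translation by simp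
      then have "(+) (vec_of_int z) ` closure S = closure S"
        by (metis closure_translation)
      then show ?thesis
        using mem_translation[of "u + vec_of_int z" "vec_of_int z" "closure S"] by simp
    qed
    ultimately have "eventually (\<lambda>P. density_in {x. \<Lambda> *v vec_of_int x \<in> closure S} P < c) large_boxes"
      by (intro eventually_density_less assms(1)) auto
    then show ?thesis
      using eventually_large_boxes_finite_nonempty
    proof eventually_elim
      case (elim P)
      have "card ({x. \<Lambda> *v vec_of_int x \<in> S} \<inter> P) \<le> card ({x. \<Lambda> *v vec_of_int x \<in> closure S} \<inter> P)"
        using elim closure_subset[of S] by (intro card_mono) auto
      then have "density_in {x. \<Lambda> *v vec_of_int x \<in> S} P \<le> density_in {x. \<Lambda> *v vec_of_int x \<in> closure S} P"
        unfolding density_in_def by (intro divide_right_mono) auto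
      with elim show ?case by linarith
    qed
  qed
  show ?thesis
  proof (rule order_tendstoI)
    fix c assume "measure lebesgue (unit_cube \<inter> E) < c"
    then show "eventually (\<lambda>P. density_in {x. \<Lambda> *v vec_of_int x \<in> E} P < c) large_boxes"
      by (intro upper per null)
  next
    fix c assume c: "c < measure lebesgue (unit_cube \<inter> E)"
    \<comment> \<open>The lower bound is the upper bound for the complement, which has the same
      frontier; measures and densities of the two sets add up to \<open>1\<close>.\<close>
    have "measure lebesgue (unit_cube - unit_cube \<inter> E) = measure lebesgue (unit_cube :: (real ^ 'm) set) - measure lebesgue (unit_cube \<inter> E)"
      using lebesgue_measurable_unit_cube lebesgue_measurable_if_frontier_null[OF null]
      by (intro measurable_measure_Diff) (auto simp: fmeasurable_def emeasure_unit_cube)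
    also have "unit_cube - unit_cube \<inter> E = unit_cube \<inter> - E" by blast
    also have "measure lebesgue (unit_cube :: (real ^ 'm) set) = 1"
      by (simp add: measure_def emeasure_unit_cube)
    finally have "measure lebesgue (unit_cube \<inter> - E) < 1 - c" using c by simp
    then have "eventually (\<lambda>P. density_in {x. \<Lambda> *v vec_of_int x \<in> - E} P < 1 - c) large_boxes"
      using per null by (intro upper) (simp_all add: frontier_complement)
    then show "eventually (\<lambda>P. c < density_in {x. \<Lambda> *v vec_of_int x \<in> E} P) large_boxes"
      using eventually_large_boxes_finite_nonempty
    proof eventually_elim
      case (elim P)
      have "{x. \<Lambda> *v vec_of_int x \<in> - E} = - {x. \<Lambda> *v vec_of_int x \<in> E}" by auto
      then show ?case using elim by (simp add: density_in_Compl)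
    qed
  qed
qed

section \<open>Almost everywhere continuous maps\<close>

lemma isCont_interior_vimage:
  assumes "isCont g u" "open U" "g u \<in> U"
  shows "u \<in> interior (g -` U)"
proof -
  obtain S where "open S" "u \<in> S" "\<forall>v\<in>S. g v \<in> U"
    using assms by (metis continuous_at_open)
  then show ?thesis by (auto intro: interiorI)
qed

text \<open>The preimage of an open set differs from its interior only at discontinuity points,
  hence by a null set.\<close>

lemma mes_continuous_borel_measurable:
  fixes g :: "real ^ 'm \<Rightarrow> 'x::metric_space"
  assumes "mes_continuous g"
  shows "g \<in> borel_measurable lebesgue"
proof (rule borel_measurableI)
  fix U :: "'x set" assume "open U"
  have "g -` U - interior (g -` U) \<subseteq> {u. \<not> isCont g u}"
    using isCont_interior_vimage[OF _ \<open>open U\<close>] by blast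
  then have "g -` U - interior (g -` U) \<in> sets lebesgue"
    using assms unfolding mes_continuous_def
    by (metis negligible_iff_null_sets negligible_subset null_setsD2)
  then have "interior (g -` U) \<union> (g -` U - interior (g -` U)) \<in> sets lebesgue"
    by (intro sets.Un) auto
  then have "g -` U \<in> sets lebesgue" by (metis Un_Diff_cancel Un_absorb1 interior_subset)
  then show "g -` U \<inter> space lebesgue \<in> sets lebesgue" by simp
qed

text \<open>Near a continuity point a value in the interior or the exterior of \<open>B\<close>
  stays there, so such a point is interior to the preimage or to its complement.\<close>

lemma frontier_vimage_subset: "frontier (g -` B) \<subseteq> {u. \<not> isCont g u} \<union> g -` frontier B"
proof
  fix u assume u: "u \<in> frontier (g -` B)"
  show "u \<in> {u. \<not> isCont g u} \<union> g -` frontier B"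
  proof (rule ccontr)
    assume "\<not> ?thesis"
    then have cont: "isCont g u" and "g u \<in> interior B \<or> g u \<in> - closure B"
      by (auto simp: frontier_def)
    then consider "u \<in> interior (g -` interior B)" | "u \<in> interior (g -` (- closure B))"
      using isCont_interior_vimage[OF cont, of "interior B"]
        isCont_interior_vimage[OF cont, of "- closure B"] by (auto simp del: vimage_Compl)
    then show False
    proof cases
      case 1
      then have "u \<in> interior (g -` B)"
        by (meson interior_mono interior_subset subsetD vimage_mono)
      then show False using u by (simp add: frontier_def)
    next
      case 2
      have "g -` (- closure B) \<subseteq> - (g -` B)" using closure_subset by blast
      then have "u \<in> interior (- (g -` B))" using 2 interior_mono by blast
      then show False using u by (simp add: frontier_def interior_complement)
    qed
  qed
qed

text \<open>Countably many translates of the part in the cube make up the whole set.\<close>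

lemma null_if_null_on_unit_cube:
  fixes E :: "(real ^ 'm) set"
  assumes per: "\<And>u z. u + vec_of_int z \<in> E \<longleftrightarrow> u \<in> E"
    and null: "unit_cube \<inter> E \<in> null_sets lebesgue"
  shows "E \<in> null_sets lebesgue"
proof -
  have "E = (\<Union>z. translate_by (unit_cube \<inter> E) z)"
  proof (rule set_eqI)
    fix u :: "real ^ 'm"
    have "\<exists>z. u - vec_of_int z \<in> unit_cube" using cell_unit_cube unfolding cell_iff by blast
    moreover have "u - vec_of_int z \<in> E \<longleftrightarrow> u \<in> E" for z using per[of "u - vec_of_int z" z] by simp
    ultimately show "u \<in> E \<longleftrightarrow> u \<in> (\<Union>z. translate_by (unit_cube \<inter> E) z)"
      by (simp add: mem_translate_by)
  qed
  moreover have "translate_by (unit_cube \<inter> E) z \<in> null_sets lebesgue" for z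
  proof -
    have "translate_by (unit_cube \<inter> E) z = (+) (vec_of_int z) ` (unit_cube \<inter> E)"
      by (simp add: translate_by_def add.commute)
    then show ?thesis
      using null by (metis negligible_iff_null_sets negligible_translation)
  qed
  ultimately show ?thesis by (metis null_sets_UN)
qed

theorem theorem5:
  fixes \<Lambda> :: "real ^ 'n ^ 'm"
    and g :: "real ^ 'm \<Rightarrow> 'x::metric_space"
  assumes "nonresonant \<Lambda>"
    and "unit_periodic g"
    and "mes_continuous g"
  shows "\<exists>D :: 'x measure.
    prob_space D \<and> sets D = sets borel \<and>
    (\<forall>V. cell V \<and> V \<in> sets lebesgue \<longrightarrow>
      (\<forall>B\<in>sets borel. V \<inter> g -` B \<in> sets lebesgue \<and>
        emeasure D B = emeasure lebesgue (V \<inter> g -` B))) \<and>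
    map_distributed D (\<lambda>x. g (\<Lambda> *v vec_of_int x)) \<and>
    generated_algebra D (\<lambda>x. g (\<Lambda> *v vec_of_int x)) \<subseteq> quasiperiodic_algebra \<Lambda>"
proof -
  note cube = lebesgue_measurable_unit_cube
  have g: "g \<in> borel_measurable lebesgue"
    using assms(3) by (rule mes_continuous_borel_measurable)
  have per: "u + vec_of_int z \<in> g -` B \<longleftrightarrow> u \<in> g -` B" for u z B
    using assms(2) by (simp add: unit_periodic_def)
  define D where "D = distr (lebesgue_on unit_cube) borel g"
  have D_eq: "emeasure D B = emeasure lebesgue (V \<inter> g -` B)"
    if "cell V" "V \<in> sets lebesgue" "B \<in> sets borel" for V B
  proof -
    have "D = distr (lebesgue_on V) borel g"
      unfolding D_def by (intro distr_cell_eq cell_unit_cube cube that assms(2) g)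
    then show ?thesis using that g by (simp add: emeasure_distr_lebesgue_on)
  qed
  have prob: "prob_space D"
    by (rule prob_spaceI) (simp add: D_def emeasure_distr_lebesgue_on[OF cube g, of UNIV] emeasure_unit_cube)
  have vimage_sets: "g -` B \<in> sets lebesgue" if "B \<in> sets borel" for B
    using measurable_sets[OF g that] by simp
  \<comment> \<open>The assumption on \<open>D\<close> controls the preimage of
    \<open>frontier B\<close> only inside the cube; periodicity extends this to the whole
    space.\<close>
  have frontier: "frontier (g -` B) \<in> null_sets lebesgue"
    if "B \<in> sets borel" "measure D (frontier B) = 0" for B
  proof -
    interpret D: prob_space D by (rule prob)
    have fB: "frontier B \<in> sets borel" by (simp add: borel_closed)
    have "emeasure D (frontier B) = 0" using that(2) by (simp add: D.emeasure_eq_measure)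
    then have "unit_cube \<inter> g -` frontier B \<in> null_sets lebesgue"
      using D_eq[OF cell_unit_cube cube fB] vimage_sets[OF fB] cube by (auto intro!: null_setsI)
    then have "g -` frontier B \<in> null_sets lebesgue"
      using per by (rule null_if_null_on_unit_cube[rotated])
    then have "{u. \<not> isCont g u} \<union> g -` frontier B \<in> null_sets lebesgue"
      using assms(3) by (auto simp: mes_continuous_def)
    then show ?thesis
      using frontier_vimage_subset by (metis negligible_iff_null_sets negligible_subset)
  qed
  have "map_distributed D (\<lambda>x. g (\<Lambda> *v vec_of_int x))"
    unfolding map_distributed_def
  proof (intro conjI ballI impI)
    fix B :: "'x set" assume B: "B \<in> sets borel" "measure D (frontier B) = 0"
    have "measure D B = measure lebesgue (unit_cube \<inter> g -` B)"
      using D_eq[OF cell_unit_cube cube B(1)] by (simp add: measure_def)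
    then have "(density_in ((\<lambda>x. g (\<Lambda> *v vec_of_int x)) -` B) \<longlongrightarrow> measure D B) large_boxes"
      using density_tendsto[OF assms(1) per frontier[OF B]] by (simp add: vimage_def)
    then show "freq_measurable ((\<lambda>x. g (\<Lambda> *v vec_of_int x)) -` B)"
      "freq ((\<lambda>x. g (\<Lambda> *v vec_of_int x)) -` B) = measure D B"
      by (rule freq_eqI)+
  qed (simp_all add: prob, simp add: D_def)
  moreover have "generated_algebra D (\<lambda>x. g (\<Lambda> *v vec_of_int x)) \<subseteq> quasiperiodic_algebra \<Lambda>"
  proof
    fix A assume "A \<in> generated_algebra D (\<lambda>x. g (\<Lambda> *v vec_of_int x))"
    then obtain B where A: "A = (\<lambda>x. g (\<Lambda> *v vec_of_int x)) -` B"
      and B: "B \<in> sets borel" "measure D (frontier B) = 0"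
      unfolding generated_algebra_def by blast
    \<comment> \<open>Cutting with the cube keeps the frontier null, since both frontiers are null,
      and the integer translates of \<open>G\<close> restore the periodic set.\<close>
    define G where "G = unit_cube \<inter> g -` B"
    have "frontier G \<in> null_sets lebesgue"
      using frontier_Int_subset[of unit_cube "g -` B"] frontier_unit_cube frontier[OF B]
      unfolding G_def by (metis negligible_Un negligible_iff_null_sets negligible_subset)
    moreover have "bounded G"
      unfolding G_def using unit_cube_subset_cbox by (meson bounded_cbox bounded_subset le_infI1)
    moreover have "A = quasiperiodic_set G \<Lambda>"
    proof (rule set_eqI)
      fix x
      define u where "u = \<Lambda> *v vec_of_int x"
      have "\<exists>z. u - vec_of_int z \<in> unit_cube" using cell_unit_cube unfolding cell_iff by blast
      moreover have "u - vec_of_int z \<in> g -` B \<longleftrightarrow> u \<in> g -` B" for z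
        using per[of "u - vec_of_int z" z] by simp
      ultimately have "u \<in> g -` B \<longleftrightarrow> u \<in> (\<Union>z. translate_by G z)"
        by (simp add: G_def mem_translate_by)
      then show "x \<in> A \<longleftrightarrow> x \<in> quasiperiodic_set G \<Lambda>"
        by (simp add: A quasiperiodic_set_def u_def)
    qed
    ultimately show "A \<in> quasiperiodic_algebra \<Lambda>"
      unfolding quasiperiodic_algebra_def jordan_measurable_def
      by (auto simp: G_def unit_cube_def)
  qed
  moreover have "sets D = sets borel" by (simp add: D_def)
  moreover have "V \<inter> g -` B \<in> sets lebesgue" if "V \<in> sets lebesgue" "B \<in> sets borel" for V B
    using that vimage_sets by blast
  ultimately show ?thesis
    using prob D_eq by blast
qed

end
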